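(* There is no datatype defining rewrite system (DDRS) for the canonical term algebra $\widehat{\mathbb F}_{cm}(\widehat{\mathbb Z})$.
   Context: DDRS. A datatype defining rewrite system (DDRS) over a given signature is a finite set $E$ of equations between terms (with variables) over that signature which, when each equation is oriented from left to right, is a ground complete term rewriting system: rewriting of closed terms is terminating and confluent, so every closed term has a unique normal form. Its canonical term algebra is the algebra over the signature whose domain is the set of closed normal forms, where an operation applied to normal forms yields the normal form of the resulting term. $E$ is a DDRS for a given canonical term algebra if its canonical term algebra is that one; i.e. the closed normal forms are exactly the prescribed canonical terms and each closed term has as its normal form the canonical term denoting the same element of the algebra. The algebra. $F(\mathbb Z)=\mathbb Z\times\mathbb Z$ is the set of fracpairs $\frac pq$ (with $q=0$ allowed). $=_{cc}$ is the smallest equivalence relation on $F(\mathbb Z)$ such that $\frac{x\cdot z}{y\cdot(z\cdot z)}=_{cc}\frac{x}{y\cdot z}$ for all $x,y,z\in\mathbb Z$; it is a congruence for the operations $\frac xy+\frac uv=\frac{x\cdot v+u\cdot y}{y\cdot v}$, $\frac xy\cdot\frac uv=\frac{x\cdot u}{y\cdot v}$, $-\frac xy=\frac{-x}{y}$, $\left(\frac xy\right)^{-1}=\frac{y\cdot y}{x\cdot y}$ with constants $0=\frac01$, $1=\frac11$, $\mathbf a=\frac10$; and $\mathbb F_{cm}(\mathbb Z)=F(\mathbb Z)/{=_{cc}}$. Signature. There is a sort of integers with the ring signature $\{0,1,-(\_),+,\cdot\}$, interpreted as the ring $\mathbb Z$; a sort of fractions with signature $\{0,1,\mathbf a,-(\_),(\_)^{-1},+,\cdot\}$,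 interpreted as $\mathbb F_{cm}(\mathbb Z)$; and the fracpairing operation $\frac{\_}{\_}$ from two integer arguments to fractions, interpreted as $(p,q)\mapsto$ the class of $\frac pq$. Canonical terms. Positive numerals are the integer terms $1$, and $n+1$ for $n$ a positive numeral (so $1,\ 1+1,\ (1+1)+1,\dots$); negative numerals are the terms $-(n)$ with $n$ a positive numeral; a numeral is $0$, a positive numeral or a negative numeral. The canonical terms of integer sort are the numerals. For a numeral $m$ write $m_{\mathbb Z}$ for the integer it denotes. The canonical terms of fraction sort are the terms $\frac nm$ with $n,m$ numerals and $m$ not a negative numeral, such that one of the following holds: (i) $n=0$ and $m_{\mathbb Z}$ is squarefree; (ii) $m=0$ and $n=1$; (iii) $m=1$; (iv) $m\neq0$, $n\neq0$, $m\neq1$, and for every prime $p$, if $m_{\mathbb Z}$ is a multiple of $p\cdot p$ then $n_{\mathbb Z}$ is not a multiple of $p$. $\widehat{\mathbb F}_{cm}(\widehat{\mathbb Z})$ is the canonical term algebra with these canonical terms, representing $\mathbb F_{cm}(\mathbb Z)$. *)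

theory Defs
  imports
    "HOL-Library.Confluence"
    "HOL-Computational_Algebra.Computational_Algebra"
begin

section \<open>The algebra of fracpairs modulo the common meadow congruence\<close>

inductive cceq :: "int \<times> int \<Rightarrow> int \<times> int \<Rightarrow> bool" where
  cceq_base: "cceq (x * z, y * (z * z)) (x, y * z)"
| cceq_refl: "cceq a a"
| cceq_sym: "cceq a b \<Longrightarrow> cceq b a"
| cceq_trans: "cceq a b \<Longrightarrow> cceq b c \<Longrightarrow> cceq a c"

lemma equivp_cceq: "equivp cceq"
  by (intro equivpI reflpI sympI transpI) (auto intro: cceq.intros)

quotient_type fcm = "int \<times> int" / cceq
  by (rule equivp_cceq)

fun fp_add :: "int \<times> int \<Rightarrow> int \<times> int \<Rightarrow> int \<times> int" where
  "fp_add (x, y) (u, v) = (x * v + u * y, y * v)"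

fun fp_mult :: "int \<times> int \<Rightarrow> int \<times> int \<Rightarrow> int \<times> int" where
  "fp_mult (x, y) (u, v) = (x * u, y * v)"

fun fp_neg :: "int \<times> int \<Rightarrow> int \<times> int" where
  "fp_neg (x, y) = (- x, y)"

fun fp_inv :: "int \<times> int \<Rightarrow> int \<times> int" where
  "fp_inv (x, y) = (y * y, x * y)"

lemma cceq_base': "a = (x * z, y * (z * z)) \<Longrightarrow> b = (x, y * z) \<Longrightarrow> cceq a b"
  by (simp add: cceq_base)

lemma fp_add_comm: "fp_add a b = fp_add b a"
  by (cases a; cases b) (simp add: algebra_simps)

lemma fp_mult_comm: "fp_mult a b = fp_mult b a"
  by (cases a; cases b) (simp add: algebra_simps)

lemma fp_add_cong_left: "cceq a b \<Longrightarrow> cceq (fp_add a c) (fp_add b c)"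
proof (induction rule: cceq.induct)
  case (cceq_base x z y)
  obtain u v where c: "c = (u, v)" by (cases c)
  show ?case
    unfolding c by (rule cceq_base'[where x = "x * v + u * (y * z)" and y = "y * v" and z = z])
      (simp_all add: algebra_simps)
qed (blast intro: cceq.intros)+

lemma fp_mult_cong_left: "cceq a b \<Longrightarrow> cceq (fp_mult a c) (fp_mult b c)"
proof (induction rule: cceq.induct)
  case (cceq_base x z y)
  obtain u v where c: "c = (u, v)" by (cases c)
  show ?case
    unfolding c by (rule cceq_base'[where x = "x * u" and y = "y * v" and z = z])
      (simp_all add: algebra_simps)
qed (blast intro: cceq.intros)+

lemma fp_neg_cong: "cceq a b \<Longrightarrow> cceq (fp_neg a) (fp_neg b)"
proof (induction rule: cceq.induct)
  case (cceq_base x z y)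
  show ?case
    by (rule cceq_base'[where x = "- x" and y = y and z = z]) simp_all
qed (blast intro: cceq.intros)+

lemma fp_inv_cong: "cceq a b \<Longrightarrow> cceq (fp_inv a) (fp_inv b)"
proof (induction rule: cceq.induct)
  case (cceq_base x z y)
  have "cceq (fp_inv (x * z, y * (z * z))) (y * y * z * z * z, x * y * z * z)"
    by (rule cceq_base'[where x = "y * y * z * z * z" and y = "x * y * z" and z = z])
      (simp_all add: algebra_simps)
  moreover have "cceq (y * y * z * z * z, x * y * z * z) (fp_inv (x, y * z))"
    by (rule cceq_base'[where x = "y * y * z * z" and y = "x * y" and z = z])
      (simp_all add: algebra_simps)
  ultimately show ?case by (rule cceq_trans)
qed (blast intro: cceq.intros)+

lift_definition fcm_frac :: "int \<Rightarrow> int \<Rightarrow> fcm" is "\<lambda>p q. (p, q)" .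

lift_definition fcm_zero :: fcm is "(0, 1)" .

lift_definition fcm_one :: fcm is "(1, 1)" .

lift_definition fcm_a :: fcm is "(1, 0)" .

lift_definition fcm_add :: "fcm \<Rightarrow> fcm \<Rightarrow> fcm" is fp_add
  by (metis cceq_trans fp_add_comm fp_add_cong_left)

lift_definition fcm_mult :: "fcm \<Rightarrow> fcm \<Rightarrow> fcm" is fp_mult
  by (metis cceq_trans fp_mult_comm fp_mult_cong_left)

lift_definition fcm_neg :: "fcm \<Rightarrow> fcm" is fp_neg
  by (rule fp_neg_cong)

lift_definition fcm_inv :: "fcm \<Rightarrow> fcm" is fp_inv
  by (rule fp_inv_cong)


section \<open>Two-sorted terms\<close>

text \<open>
  Integer terms have integer variables only; fraction terms may contain variables of both sorts
  (type parameters \<open>'v\<close> for the integer sort and \<open>'w\<close> for the fraction sort).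
\<close>

datatype (ivars: 'v) iterm =
    IVar 'v
  | IZero
  | IOne
  | INeg "'v iterm"
  | IAdd "'v iterm" "'v iterm"
  | IMul "'v iterm" "'v iterm"

datatype (fivars: 'v, ffvars: 'w) fterm =
    FVar 'w
  | FZero
  | FOne
  | FA
  | FNeg "('v, 'w) fterm"
  | FInv "('v, 'w) fterm"
  | FAdd "('v, 'w) fterm" "('v, 'w) fterm"
  | FMul "('v, 'w) fterm" "('v, 'w) fterm"
  | Frac "'v iterm" "'v iterm"

definition iclosed :: "'v iterm \<Rightarrow> bool" where
  "iclosed t \<longleftrightarrow> ivars t = {}"

definition fclosed :: "('v, 'w) fterm \<Rightarrow> bool" where
  "fclosed t \<longleftrightarrow> fivars t = {} \<and> ffvars t = {}"

text \<open>
  The interpretations are only ever used on closed terms; the clauses for variables are dummies.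
\<close>

primrec ival :: "'v iterm \<Rightarrow> int" where
  "ival (IVar v) = 0"
| "ival IZero = 0"
| "ival IOne = 1"
| "ival (INeg t) = - ival t"
| "ival (IAdd s t) = ival s + ival t"
| "ival (IMul s t) = ival s * ival t"

primrec fval :: "('v, 'w) fterm \<Rightarrow> fcm" where
  "fval (FVar w) = fcm_zero"
| "fval FZero = fcm_zero"
| "fval FOne = fcm_one"
| "fval FA = fcm_a"
| "fval (FNeg t) = fcm_neg (fval t)"
| "fval (FInv t) = fcm_inv (fval t)"
| "fval (FAdd s t) = fcm_add (fval s) (fval t)"
| "fval (FMul s t) = fcm_mult (fval s) (fval t)"
| "fval (Frac s t) = fcm_frac (ival s) (ival t)"

primrec isubst :: "('v \<Rightarrow> 'u iterm) \<Rightarrow> 'v iterm \<Rightarrow> 'u iterm" where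
  "isubst \<sigma> (IVar v) = \<sigma> v"
| "isubst \<sigma> IZero = IZero"
| "isubst \<sigma> IOne = IOne"
| "isubst \<sigma> (INeg t) = INeg (isubst \<sigma> t)"
| "isubst \<sigma> (IAdd s t) = IAdd (isubst \<sigma> s) (isubst \<sigma> t)"
| "isubst \<sigma> (IMul s t) = IMul (isubst \<sigma> s) (isubst \<sigma> t)"

primrec fsubst ::
  "('v \<Rightarrow> 'u iterm) \<Rightarrow> ('w \<Rightarrow> ('u, 'x) fterm) \<Rightarrow> ('v, 'w) fterm \<Rightarrow> ('u, 'x) fterm" where
  "fsubst \<sigma> \<tau> (FVar w) = \<tau> w"
| "fsubst \<sigma> \<tau> FZero = FZero"
| "fsubst \<sigma> \<tau> FOne = FOne"
| "fsubst \<sigma> \<tau> FA = FA"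
| "fsubst \<sigma> \<tau> (FNeg t) = FNeg (fsubst \<sigma> \<tau> t)"
| "fsubst \<sigma> \<tau> (FInv t) = FInv (fsubst \<sigma> \<tau> t)"
| "fsubst \<sigma> \<tau> (FAdd s t) = FAdd (fsubst \<sigma> \<tau> s) (fsubst \<sigma> \<tau> t)"
| "fsubst \<sigma> \<tau> (FMul s t) = FMul (fsubst \<sigma> \<tau> s) (fsubst \<sigma> \<tau> t)"
| "fsubst \<sigma> \<tau> (Frac s t) = Frac (isubst \<sigma> s) (isubst \<sigma> t)"


section \<open>Rewriting\<close>

text \<open>
  An equation relates two terms of the same sort; as a rewrite rule it is oriented from its first
  to its second argument. Neither \<open>FVar\<close>/\<open>IVar\<close> left-hand sides nor extra variables on the right
  are excluded syntactically, so the usual variable conditions on rewrite rules are not needed as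
  assumptions in non-existence results.
\<close>

datatype ('v, 'w) equation =
    IEq "'v iterm" "'v iterm"
  | FEq "('v, 'w) fterm" "('v, 'w) fterm"

inductive istep :: "('v, 'w) equation set \<Rightarrow> 'v iterm \<Rightarrow> 'v iterm \<Rightarrow> bool"
  for E where
  "IEq l r \<in> E \<Longrightarrow> istep E (isubst \<sigma> l) (isubst \<sigma> r)"
| "istep E s s' \<Longrightarrow> istep E (INeg s) (INeg s')"
| "istep E s s' \<Longrightarrow> istep E (IAdd s t) (IAdd s' t)"
| "istep E t t' \<Longrightarrow> istep E (IAdd s t) (IAdd s t')"
| "istep E s s' \<Longrightarrow> istep E (IMul s t) (IMul s' t)"
| "istep E t t' \<Longrightarrow> istep E (IMul s t) (IMul s t')"

inductive fstep :: "('v, 'w) equation set \<Rightarrow> ('v, 'w) fterm \<Rightarrow> ('v, 'w) fterm \<Rightarrow> bool"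
  for E where
  "FEq l r \<in> E \<Longrightarrow> fstep E (fsubst \<sigma> \<tau> l) (fsubst \<sigma> \<tau> r)"
| "fstep E s s' \<Longrightarrow> fstep E (FNeg s) (FNeg s')"
| "fstep E s s' \<Longrightarrow> fstep E (FInv s) (FInv s')"
| "fstep E s s' \<Longrightarrow> fstep E (FAdd s t) (FAdd s' t)"
| "fstep E t t' \<Longrightarrow> fstep E (FAdd s t) (FAdd s t')"
| "fstep E s s' \<Longrightarrow> fstep E (FMul s t) (FMul s' t)"
| "fstep E t t' \<Longrightarrow> fstep E (FMul s t) (FMul s t')"
| "istep E p p' \<Longrightarrow> fstep E (Frac p q) (Frac p' q)"
| "istep E q q' \<Longrightarrow> fstep E (Frac p q) (Frac p q')"

definition ground_istep :: "('v, 'w) equation set \<Rightarrow> 'v iterm \<Rightarrow> 'v iterm \<Rightarrow> bool" where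
  "ground_istep E s t \<longleftrightarrow> iclosed s \<and> iclosed t \<and> istep E s t"

definition ground_fstep ::
  "('v, 'w) equation set \<Rightarrow> ('v, 'w) fterm \<Rightarrow> ('v, 'w) fterm \<Rightarrow> bool" where
  "ground_fstep E s t \<longleftrightarrow> fclosed s \<and> fclosed t \<and> fstep E s t"

definition complete_rel :: "('a \<Rightarrow> 'a \<Rightarrow> bool) \<Rightarrow> bool" where
  "complete_rel R \<longleftrightarrow> wfp R\<inverse>\<inverse> \<and> confluentp R"

definition normal :: "('a \<Rightarrow> 'a \<Rightarrow> bool) \<Rightarrow> 'a \<Rightarrow> bool" where
  "normal R t \<longleftrightarrow> (\<nexists>u. R t u)"

definition nf_of :: "('a \<Rightarrow> 'a \<Rightarrow> bool) \<Rightarrow> 'a \<Rightarrow> 'a \<Rightarrow> bool" where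
  "nf_of R t n \<longleftrightarrow> R\<^sup>*\<^sup>* t n \<and> normal R n"

definition DDRS :: "('v, 'w) equation set \<Rightarrow> bool" where
  "DDRS E \<longleftrightarrow> finite E \<and> complete_rel (ground_istep E) \<and> complete_rel (ground_fstep E)"

text \<open>
  The target canonical term algebra is given by its sets \<open>CI\<close>, \<open>CF\<close> of canonical terms of
  the two sorts, together with the interpretations \<open>vi\<close>, \<open>vf\<close> of closed terms in the
  algebra it represents.
\<close>

definition DDRS_for ::
  "'v iterm set \<Rightarrow> ('v, 'w) fterm set \<Rightarrow> ('v iterm \<Rightarrow> 'a) \<Rightarrow> (('v, 'w) fterm \<Rightarrow> 'b)
    \<Rightarrow> ('v, 'w) equation set \<Rightarrow> bool" where
  "DDRS_for CI CF vi vf E \<longleftrightarrow>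
     DDRS E \<and>
     {t. iclosed t \<and> normal (ground_istep E) t} = CI \<and>
     {t. fclosed t \<and> normal (ground_fstep E) t} = CF \<and>
     (\<forall>t n. iclosed t \<and> nf_of (ground_istep E) t n \<longrightarrow> vi n = vi t) \<and>
     (\<forall>t n. fclosed t \<and> nf_of (ground_fstep E) t n \<longrightarrow> vf n = vf t)"


section \<open>Canonical terms\<close>

inductive pos_num :: "'v iterm \<Rightarrow> bool" where
  "pos_num IOne"
| "pos_num n \<Longrightarrow> pos_num (IAdd n IOne)"

definition neg_num :: "'v iterm \<Rightarrow> bool" where
  "neg_num t \<longleftrightarrow> (\<exists>n. pos_num n \<and> t = INeg n)"

definition is_num :: "'v iterm \<Rightarrow> bool" where
  "is_num t \<longleftrightarrow> t = IZero \<or> pos_num t \<or> neg_num t"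

definition canonical_int :: "'v iterm set" where
  "canonical_int = {t. is_num t}"

definition canonical_frac :: "('v, 'w) fterm set" where
  "canonical_frac = {Frac n m | n m.
     is_num n \<and> is_num m \<and> \<not> neg_num m \<and>
     (n = IZero \<and> squarefree (ival m) \<or>
      m = IZero \<and> n = IOne \<or>
      m = IOne \<or>
      m \<noteq> IZero \<and> n \<noteq> IZero \<and> m \<noteq> IOne \<and>
        (\<forall>p::int. prime p \<longrightarrow> p * p dvd ival m \<longrightarrow> \<not> p dvd ival n))}"

end

(* The terms 0/m with m a positive numeral are normal exactly when m is squarefree. Numerals are
   normal, so for large non-squarefree m a rule has to match 0/m at the root. Since m exceeds the
   size of the left-hand side, the pattern for the denominator is a variable with finitely many
   ones added, and enlarging the value of that variable makes the same rule match 0/p for a large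
   prime p, although 0/p is normal. *)
theory Submission
  imports Defs
begin

text \<open>The shift by one (\<open>pnum m\<close> denotes \<open>m + 1\<close>) avoids positivity side conditions.\<close>

primrec pnum :: "nat \<Rightarrow> 'v iterm" where
  "pnum 0 = IOne"
| "pnum (Suc n) = IAdd (pnum n) IOne"

lemma ival_pnum [simp]: "ival (pnum m) = int (Suc m)"
  by (induction m) auto

lemma ivars_pnum [simp]: "ivars (pnum m) = {}"
  by (induction m) auto

lemma pos_num_pnum [simp]: "pos_num (pnum m)"
  by (induction m) (auto intro: pos_num.intros)

lemma pnum_neq_IZero [simp]: "pnum m \<noteq> IZero"
  by (cases m) auto

lemma pnum_eq_IOne_iff [simp]: "pnum m = IOne \<longleftrightarrow> m = 0"
  by (cases m) auto

lemma not_neg_num_pnum [simp]: "\<not> neg_num (pnum m)"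
  by (cases m) (auto simp: neg_num_def)

text \<open>A zero numerator leaves the squarefree clause and the clause for denominator
  \<open>IOne\<close>; the latter is subsumed, as 1 is squarefree.\<close>

lemma Frac_IZero_pnum_canonical_iff:
  "Frac IZero (pnum m) \<in> canonical_frac \<longleftrightarrow> squarefree (int (Suc m))"
  by (auto simp: canonical_frac_def is_num_def)

text \<open>A term with an atomic instance \<open>c\<close> is \<open>c\<close> itself or a variable
  sent to \<open>c\<close>, and that variable cannot be \<open>x\<close>.\<close>

lemma isubst_upd_other:
  assumes "isubst \<sigma> s = c" and "c = IZero \<or> c = IOne" and "\<sigma> x \<noteq> c"
  shows "isubst (\<sigma>(x := u)) s = c"
  using assms by (cases s) auto

text \<open>Follow the left spine of \<open>t\<close>, which must match the left-nested sum
  \<open>pnum m\<close>. Being shorter than that sum, it ends in a variable \<open>x\<close> that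
  absorbs the rest, and enlarging this rest enlarges the whole numeral.\<close>

lemma isubst_eq_pnum_pump:
  assumes "isubst \<sigma> t = pnum m" and "size t < m"
  shows "\<exists>x j. \<sigma> x = pnum (Suc j) \<and> (\<forall>d. isubst (\<sigma>(x := pnum (Suc j + d))) t = pnum (m + d))"
  using assms
proof (induction t arbitrary: m)
  case (IVar y)
  then obtain j where "m = Suc j"
    by (cases m) auto
  with IVar show ?case
    by (intro exI[of _ y] exI[of _ j]) auto
next
  case (IAdd t1 t2)
  obtain k where m: "m = Suc k"
    using IAdd.prems by (cases m) auto
  have t1: "isubst \<sigma> t1 = pnum k" and t2: "isubst \<sigma> t2 = IOne"
    using IAdd.prems m by auto
  have "size t1 < k"
    using IAdd.prems(2) m by simp
  then obtain x j where x: "\<sigma> x = pnum (Suc j)"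
    and pump: "\<And>d. isubst (\<sigma>(x := pnum (Suc j + d))) t1 = pnum (k + d)"
    using IAdd.IH(1)[OF t1] by blast
  \<comment> \<open>The index \<open>Suc j\<close> matters here: \<open>x\<close> has a value other
    than \<open>IOne\<close>, so the summands that become \<open>IOne\<close> do not change when
    \<open>x\<close> does.\<close>
  have "isubst (\<sigma>(x := pnum (Suc j + d))) t2 = IOne" for d
    using isubst_upd_other[OF t2] x by simp
  with x pump m show ?case
    by (intro exI[of _ x] exI[of _ j]) (auto simp del: fun_upd_apply)
qed (auto simp: gr0_conv_Suc Suc_less_eq2)

lemma ivars_isubst_upd:
  assumes "ivars (isubst \<sigma> t) = {}" and "ivars c = {}"
  shows "ivars (isubst (\<sigma>(x := c)) t) = {}"
  using assms by (induction t) auto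

text \<open>Ground steps have closed targets, so a rule instance with a modified substitution needs
  its right-hand side closed again.\<close>

lemma fclosed_fsubst_ivar_upd:
  assumes "fclosed (fsubst \<sigma> \<tau> r)" and "iclosed c"
  shows "fclosed (fsubst (\<sigma>(x := c)) \<tau> r)"
  using assms by (induction r) (auto simp: fclosed_def iclosed_def ivars_isubst_upd)

lemma fclosed_fsubst_fvar_upd:
  assumes "fclosed (fsubst \<sigma> \<tau> r)" and "fclosed c"
  shows "fclosed (fsubst \<sigma> (\<tau>(w := c)) r)"
  using assms by (induction r) (auto simp: fclosed_def)

theorem theorem3p2p1:
  shows "\<not> (\<exists>E :: (nat, nat) equation set. DDRS_for canonical_int canonical_frac ival fval E)"
proof
  assume "\<exists>E :: (nat, nat) equation set. DDRS_for canonical_int canonical_frac ival fval E"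
  then obtain E :: "(nat, nat) equation set" where fin: "finite E"
    and "{t. iclosed t \<and> normal (ground_istep E) t} = canonical_int"
    and "{t. fclosed t \<and> normal (ground_fstep E) t} = canonical_frac"
    by (auto simp: DDRS_for_def DDRS_def)
  then have int_nf: "\<not> ground_istep E t u" if "is_num t" for t u
    using that by (auto simp: canonical_int_def normal_def)
  have frac_nf: "fclosed t \<and> (\<forall>u. \<not> ground_fstep E t u) \<longleftrightarrow> t \<in> canonical_frac" for t
    using \<open>{t. fclosed t \<and> normal (ground_fstep E) t} = canonical_frac\<close>
    by (auto simp: normal_def)

  \<comment> \<open>Rules without a fraction on the left get size 0, so that a single bound
    \<open>B\<close> covers the finite set \<open>E\<close>.\<close>
  define den_size where "den_size e = (case e of FEq (Frac s t) r \<Rightarrow> size t | _ \<Rightarrow> 0)"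
    for e :: "(nat, nat) equation"
  obtain B where B: "\<And>e. e \<in> E \<Longrightarrow> den_size e \<le> B"
    using finite_imageI[OF fin, of den_size] by (auto simp: finite_nat_set_iff_bounded_le)
  \<comment> \<open>\<open>pnum m\<close> denotes \<open>4 * (B + 1)\<close>, a multiple of the
    square 4, and \<open>m\<close> exceeds every denominator pattern size.\<close>
  define m where "m = 4 * B + 3"
  have "2\<^sup>2 dvd int (Suc m)"
    by (simp add: m_def)
  then have "\<not> squarefree (int (Suc m))"
    using not_squarefreeI[of 2 "int (Suc m)"] by simp
  then have "Frac IZero (pnum m) \<notin> (canonical_frac :: (nat, nat) fterm set)"
    by (simp add: Frac_IZero_pnum_canonical_iff)
  moreover have "fclosed (Frac IZero (pnum m) :: (nat, nat) fterm)"
    by (simp add: fclosed_def)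
  ultimately obtain u where "ground_fstep E (Frac IZero (pnum m)) u"
    using frac_nf by blast
  then have u: "fclosed u" and step: "fstep E (Frac IZero (pnum m)) u"
    by (auto simp: ground_fstep_def)

  from step show False
  proof (cases rule: fstep.cases)
    case (1 l r \<sigma> \<tau>)
    show False
    proof (cases l)
      case (FVar w)
      \<comment> \<open>A variable as left-hand side matches every fraction term, so it would also
        rewrite the canonical term 1/0.\<close>
      define \<tau>' where "\<tau>' = \<tau>(w := Frac IOne IZero)"
      have "fclosed (fsubst \<sigma> \<tau>' r)"
        unfolding \<tau>'_def using u 1 by (intro fclosed_fsubst_fvar_upd) (auto simp: fclosed_def)
      moreover have "fstep E (fsubst \<sigma> \<tau>' l) (fsubst \<sigma> \<tau>' r)"
        using 1 by (auto intro: fstep.intros)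
      ultimately have "ground_fstep E (Frac IOne IZero) (fsubst \<sigma> \<tau>' r)"
        using FVar by (simp add: ground_fstep_def \<tau>'_def fclosed_def)
      moreover have "Frac IOne IZero \<in> (canonical_frac :: (nat, nat) fterm set)"
        by (auto simp: canonical_frac_def is_num_def neg_num_def intro: pos_num.intros)
      ultimately show False
        using frac_nf by blast
    next
      case (Frac s t)
      have s: "isubst \<sigma> s = IZero" and t: "isubst \<sigma> t = pnum m"
        using 1 Frac by auto
      have "size t < m"
        using B[OF 1(3)] Frac by (simp add: den_size_def m_def)
      then obtain x j where x: "\<sigma> x = pnum (Suc j)"
        and pump: "\<And>d. isubst (\<sigma>(x := pnum (Suc j + d))) t = pnum (m + d)"
        using isubst_eq_pnum_pump[OF t] by blast
      obtain p :: nat where p: "prime p" "m + 1 < p"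
        using bigger_prime by blast
      \<comment> \<open>Raising the index \<open>m\<close> by \<open>p - 1 - m\<close> gives
        \<open>pnum (p - 1)\<close>, which denotes \<open>p\<close>.\<close>
      define \<sigma>' where "\<sigma>' = \<sigma>(x := pnum (Suc j + (p - 1 - m)))"
      \<comment> \<open>The numerator pattern may share variables with the denominator, but
        \<open>x\<close> has a nonzero numeral as value.\<close>
      have "isubst \<sigma>' s = IZero"
        unfolding \<sigma>'_def using s x by (intro isubst_upd_other) auto
      moreover have "isubst \<sigma>' t = pnum (p - 1)"
        unfolding \<sigma>'_def using pump[of "p - 1 - m"] p by simp
      ultimately have "fsubst \<sigma>' \<tau> l = Frac IZero (pnum (p - 1))"
        using Frac by simp
      moreover have "fclosed (fsubst \<sigma>' \<tau> r)"
        unfolding \<sigma>'_def using u 1 by (intro fclosed_fsubst_ivar_upd) (auto simp: iclosed_def)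
      moreover have "fstep E (fsubst \<sigma>' \<tau> l) (fsubst \<sigma>' \<tau> r)"
        using 1 by (auto intro: fstep.intros)
      ultimately have "ground_fstep E (Frac IZero (pnum (p - 1))) (fsubst \<sigma>' \<tau> r)"
        by (simp add: ground_fstep_def fclosed_def)
      moreover have "squarefree (int (Suc (p - 1)))"
        using p by (simp add: squarefree_prime)
      ultimately show False
        using frac_nf by (metis Frac_IZero_pnum_canonical_iff)
    qed (use 1 in auto)
  next
    \<comment> \<open>A step inside the numerator or the denominator would rewrite a numeral, which
      is normal.\<close>
    case (8 p')
    then show False
      using int_nf[of IZero] u by (auto simp: ground_istep_def fclosed_def iclosed_def is_num_def)
  next
    case (9 q')
    then show False
      using int_nf[of "pnum m"] u
      by (auto simp: ground_istep_def fclosed_def iclosed_def is_num_def)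
  qed
qed

end
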